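(* For any $s=\Omega(\log\log n)$, $\lambda(s,n)=\Omega\!\left(n\left(\frac{s}{2\log\log_s n+1}\right)^{\log\log_s n+1}\right)$. In particular, $\lambda(\log n,n)/n=2^{\Omega((\log\log n)^2)}$.
   Context: A sequence $S$ over an alphabet is an order-$s$ Davenport–Schinzel sequence if it contains no immediate repetition (no two equal consecutive symbols) and contains no alternating subsequence $a\,b\,a\,b\cdots$ (with $a\neq b$) of length $s+2$. Let $DS(s,n)$ be the set of order-$s$ Davenport–Schinzel sequences using exactly $n$ distinct symbols, and $\lambda(s,n)=\max\{|S| : S\in DS(s,n)\}$, where $|S|$ is the length of $S$. Here $\log_s n$ is the logarithm of $n$ to base $s$, $\log\log_s n=\log(\log_s n)$, and asymptotic notation is with respect to $n\to\infty$.
   Formalization: The bound is undefined for large s (e.g. s = n^3 gives a negative base with irrational exponent), so the first claim additionally assumes that 2 log log_s n + 1 is eventually at least some constant d > 0; this holds whenever s ≤ n. *)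

theory Defs
  imports Complex_Main "HOL-Library.Sublist" "HOL-Library.Landau_Symbols"
begin

text \<open>The word \<open>a b a b \<dots>\<close> of length \<open>k\<close>.\<close>

definition alternation :: "'a \<Rightarrow> 'a \<Rightarrow> nat \<Rightarrow> 'a list" where
  "alternation a b k = map (\<lambda>i. if even i then a else b) [0..<k]"

text \<open>Subsequences (\<^const>\<open>subseq\<close>) need not be contiguous.\<close>

definition DS_sequence :: "nat \<Rightarrow> 'a list \<Rightarrow> bool" where
  "DS_sequence s w \<longleftrightarrow>
     distinct_adj w \<and> (\<forall>a b. a \<noteq> b \<longrightarrow> \<not> subseq (alternation a b (s + 2)) w)"

text \<open>Symbols are drawn from \<^typ>\<open>nat\<close>; only the number of distinct symbols that occur matters.\<close>

definition DS :: "nat \<Rightarrow> nat \<Rightarrow> nat list set" where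
  "DS s n = {w. DS_sequence s w \<and> card (set w) = n}"

text \<open>
  The lengths are bounded by \<open>s * (n choose 2) + 1\<close>, so the maximum exists whenever
  \<^term>\<open>DS s n\<close> is nonempty, in particular for \<open>s \<ge> 1\<close>.
\<close>

definition DS_max :: "nat \<Rightarrow> nat \<Rightarrow> nat" where
  "DS_max s n = Max (length ` DS s n)"

text \<open>\<open>log log\<^sub>s n\<close>; a logarithm without explicit base is binary.\<close>

definition loglog_base :: "nat \<Rightarrow> nat \<Rightarrow> real" where
  "loglog_base s n = log 2 (log (real s) (real n))"

end

theory Submission
  imports Defs
    "HOL-Algebra.Algebraic_Closure_Type"
    "HOL-Library.Z2"
    "HOL-Real_Asymp.Real_Asymp"
begin

text \<open>
  Write \<open>R s n\<close> for \<open>\<lambda>(s, n) / n\<close>. Let \<open>q\<close> be a power of two and take the \<open>q ^ 2\<close> lines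
  \<open>y = a x + b\<close> over the field with \<open>q\<close> elements as symbols. For each of \<open>k \<le> q\<close> values of \<open>x\<close>, the
  lines fall into \<open>q\<close> blocks of size \<open>q\<close> according to \<open>y\<close>; on every block place an order-\<open>s\<close> sequence
  and concatenate. Two lines share at most one block, so the result has order \<open>s + 2 (k - 1)\<close>, whence
  \<open>R (s + 2 (k - 1)) (q ^ 2) \<ge> k R s q\<close>.

  With \<open>L = log log\<^sub>s n\<close> and \<open>l = \<lfloor>L\<rfloor>\<close>, iterate \<open>l\<close> times with \<open>k = \<lceil>x\<rceil>\<close>, \<open>x = s / (2 L + 1)\<close>, starting
  from the largest power of two below \<open>n powr (1 / 2 ^ l) = s powr (2 powr (L - l))\<close>. All rounding
  of \<open>n\<close> happens at this bottom level and once at the top, so only a constant factor is lost. The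
  remaining budget \<open>x (2 (L - l) + 1)\<close> pays for one more step followed by the trivial bound
  \<open>R s n \<ge> s / 2\<close>; this gives the missing factor \<open>x powr (1 + L - l)\<close> because \<open>2 f \<le> 2 powr f\<close>
  for \<open>f \<le> 1\<close>.
\<close>

section \<open>Finite fields of characteristic two\<close>

lemma two_eq_0_alg_closure_bit: "(2 :: bit alg_closure) = 0"
  by (metis bit_2_eq_0 to_ac_0 to_ac_numeral)

text \<open>Squaring is additive because the cross term \<open>2 * x * y\<close> vanishes; iterating
  this gives additivity of every power of the Frobenius map.\<close>

lemma add_power_two_power_char_two:
  fixes x y :: "'a :: comm_ring_1"
  assumes "(2 :: 'a) = 0"
  shows "(x + y) ^ (2 ^ j) = x ^ (2 ^ j) + y ^ (2 ^ j)"
proof (induction j)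
  case (Suc j)
  have sq: "(u + v) ^ 2 = u ^ 2 + v ^ 2" for u v :: 'a
    using assms by (simp add: power2_sum)
  have "(x + y) ^ (2 ^ Suc j) = ((x + y) ^ (2 ^ j)) ^ 2"
    by (simp flip: power_mult add: mult.commute)
  also have "\<dots> = x ^ (2 ^ Suc j) + y ^ (2 ^ Suc j)"
    by (simp add: Suc sq flip: power_mult) (simp add: mult.commute)
  finally show ?case .
qed simp

text \<open>The field with \<open>q = 2 ^ j\<close> elements is realised as the fixed points of
  \<open>x \<mapsto> x ^ q\<close>, that is, the roots of X^q - X in an algebraic closure. This
  polynomial splits there, and its roots are simple, so there are exactly \<open>q\<close> of them.
  The closure properties follow from additivity of Frobenius.\<close>

lemma finite_subfield_char_two:
  assumes "j > 0"
  obtains F :: "bit alg_closure set"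
  where "finite F" "card F = 2 ^ j"
    "\<And>x y. x \<in> F \<Longrightarrow> y \<in> F \<Longrightarrow> x - y \<in> F"
    "\<And>x y. x \<in> F \<Longrightarrow> y \<in> F \<Longrightarrow> x + y \<in> F"
    "\<And>x y. x \<in> F \<Longrightarrow> y \<in> F \<Longrightarrow> x * y \<in> F"
proof -
  define q :: nat where "q = 2 ^ j"
  define p :: "bit alg_closure poly" where "p = monom 1 q + monom (-1) 1"
  have q: "q > 1" using assms unfolding q_def by (metis one_less_numeral_iff one_less_power semiring_norm(76))
  have q0: "(of_nat q :: bit alg_closure) = 0"
    using assms two_eq_0_alg_closure_bit by (simp add: q_def)
  have deg: "degree p = q"
    unfolding p_def using q by (subst degree_add_eq_left) (simp_all add: degree_monom_eq)
  have p0: "p \<noteq> 0" using deg q by auto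
  \<comment> \<open>Separability: the leading term differentiates to a multiple of \<open>q\<close>,
    which is 0 here. A double root would also be a root of the derivative, a nonzero
    constant.\<close>
  have "pderiv p = - 1"
    unfolding p_def by (simp add: pderiv_add pderiv_monom q0 monom_0 one_pCons)
  hence order: "order x p \<le> 1" for x
  proof (rule contrapos_pp)
    assume "\<not> order x p \<le> 1"
    hence "[:- x, 1:] ^ 2 dvd p" by (simp add: order_divides)
    then obtain r where "p = [:- x, 1:] ^ 2 * r" by (elim dvdE)
    hence "poly (pderiv p) x = 0" by (simp add: power2_eq_square pderiv_mult del: mult_pCons_left mult_pCons_right)
    thus "pderiv p \<noteq> - 1" by auto
  qed
  have root: "poly p x = 0 \<longleftrightarrow> x ^ q = x" for x
    by (simp add: p_def poly_monom)
  obtain A where A: "size A = degree p" "p = smult (lead_coeff p) (\<Prod>x\<in>#A. [:- x, 1:])"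
    using alg_closed_imp_factorization[OF p0] by blast
  have "proots p = proots (\<Prod>x\<in>#A. [:- x, 1:])"
    using p0 by (subst A(2)) (simp del: One_nat_def)
  also have "\<dots> = A"
    by (induction A) (simp_all add: proots_mult prod_mset_zero_iff image_iff del: mult_pCons_left)
  finally have size: "size (proots p) = q" using A(1) deg by simp
  have "count (proots p) x = (if poly p x = 0 then 1 else 0)" for x
    using order[of x] p0 by (auto simp: order_root le_Suc_eq)
  hence "size (proots p) = card {x. poly p x = 0}"
    using p0 by (simp add: size_multiset_overloaded_eq)
  hence card: "card {x :: bit alg_closure. x ^ q = x} = q"
    unfolding size root by (rule sym)
  have add: "(x + y) ^ q = x ^ q + y ^ q" for x y :: "bit alg_closure"
    unfolding q_def by (rule add_power_two_power_char_two[OF two_eq_0_alg_closure_bit])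
  have minus: "x - y = x + y" for x y :: "bit alg_closure"
  proof -
    have "y + y = 0" using two_eq_0_alg_closure_bit by (simp flip: mult_2)
    thus ?thesis by (simp add: diff_eq_eq add.assoc)
  qed
  show ?thesis
  proof (rule that[of "{x. x ^ q = x}"])
    show "finite {x :: bit alg_closure. x ^ q = x}"
      using card q by (metis card.infinite not_one_less_zero)
  qed (use card in \<open>auto simp: q_def[symmetric] add minus power_mult_distrib\<close>)
qed

section \<open>Alternations\<close>

text \<open>A greedy scan for a, b, a, ...; exchanging the two arguments after a match records which
  letter is awaited next.\<close>

fun alt_len :: "'a \<Rightarrow> 'a \<Rightarrow> 'a list \<Rightarrow> nat" where
  "alt_len a b [] = 0"
| "alt_len a b (x # w) = (if x = a then Suc (alt_len b a w) else alt_len a b w)"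

lemma alternation_0 [simp]: "alternation a b 0 = []"
  by (simp add: alternation_def)

lemma alternation_Suc: "alternation a b (Suc k) = a # alternation b a k"
proof -
  have "[0..<Suc k] = 0 # map Suc [0..<k]"
    by (simp add: map_Suc_upt upt_conv_Cons del: upt_Suc)
  thus ?thesis by (simp add: alternation_def o_def del: upt_Suc)
qed

text \<open>Greedy matching is optimal for subsequences, so the forbidden pattern turns into a
  numerical bound on \<open>alt_len\<close>.\<close>

lemma subseq_alternation_iff: "subseq (alternation a b k) w \<longleftrightarrow> k \<le> alt_len a b w"
proof (induction w arbitrary: a b k)
  case Nil
  show ?case by (cases k) (auto simp: alternation_Suc)
next
  case (Cons x w)
  show ?case
  proof (cases k)
    case (Suc k')
    thus ?thesis
      using Cons.IH[of a b "Suc k'"] Cons.IH[of b a k']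
      by (auto simp: alternation_Suc)
  qed simp
qed

lemma DS_sequence_iff:
  "DS_sequence s w \<longleftrightarrow> distinct_adj w \<and> (\<forall>a b. a \<noteq> b \<longrightarrow> alt_len a b w \<le> s + 1)"
  by (auto simp: DS_sequence_def subseq_alternation_iff not_le less_Suc_eq_le)

text \<open>The parity of the number of letters matched in \<open>u\<close> determines which letter
  is awaited when \<open>v\<close> begins.\<close>

lemma alt_len_append:
  "alt_len a b (u @ v) =
     alt_len a b u + (if even (alt_len a b u) then alt_len a b v else alt_len b a v)"
  by (induction u arbitrary: a b) auto

text \<open>Unlike \<open>alt_len\<close>, the maximum over both starting letters is subadditive under concatenation.\<close>

definition alts :: "'a \<Rightarrow> 'a \<Rightarrow> 'a list \<Rightarrow> nat" where
  "alts a b w = max (alt_len a b w) (alt_len b a w)"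

lemma alts_Nil [simp]: "alts a b [] = 0"
  by (simp add: alts_def)

lemma alts_append: "alts a b (u @ v) \<le> alts a b u + alts a b v"
  by (auto simp: alts_def alt_len_append)

lemma alt_len_eq_0: "a \<notin> set w \<Longrightarrow> alt_len a b w = 0"
  by (induction w) auto

lemma alt_len_le_1: "b \<notin> set w \<Longrightarrow> alt_len a b w \<le> 1"
  by (induction w) (auto simp: alt_len_eq_0)

lemma alts_eq_0: "a \<notin> set w \<Longrightarrow> b \<notin> set w \<Longrightarrow> alts a b w = 0"
  by (simp add: alts_def alt_len_eq_0)

lemma alts_le_1: "a \<notin> set w \<or> b \<notin> set w \<Longrightarrow> alts a b w \<le> 1"
  using alt_len_le_1[of a w b] alt_len_le_1[of b w a] by (auto simp: alts_def alt_len_eq_0)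

lemma DS_sequence_iff_alts:
  "DS_sequence s w \<longleftrightarrow> distinct_adj w \<and> (\<forall>a b. a \<noteq> b \<longrightarrow> alts a b w \<le> s + 1)"
  unfolding DS_sequence_iff alts_def by fastforce

lemma DS_sequence_alts: "DS_sequence s w \<Longrightarrow> a \<noteq> b \<Longrightarrow> alts a b w \<le> s + 1"
  by (simp add: DS_sequence_iff_alts)

lemma DS_sequence_mono: "DS_sequence s w \<Longrightarrow> s \<le> t \<Longrightarrow> DS_sequence t w"
  unfolding DS_sequence_iff by (meson add_le_mono1 le_trans)

lemma alt_len_map:
  assumes "inj_on f (insert a (insert b (set w)))"
  shows "alt_len (f a) (f b) (map f w) = alt_len a b w"
  using assms
proof (induction w arbitrary: a b)
  case (Cons x w)
  have "f x = f a \<longleftrightarrow> x = a"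
    using Cons.prems by (auto simp: inj_on_def)
  moreover have "alt_len (f a) (f b) (map f w) = alt_len a b w"
    "alt_len (f b) (f a) (map f w) = alt_len b a w"
    using Cons.prems by (intro Cons.IH; auto simp: inj_on_def)+
  ultimately show ?case by simp
qed simp

lemma DS_sequence_map:
  fixes f :: "'a \<Rightarrow> 'b"
  assumes w: "DS_sequence s w" and f: "inj_on f (set w)" and s: "s \<ge> 1"
  shows "DS_sequence s (map f w)"
  unfolding DS_sequence_iff
proof (intro conjI allI impI)
  show "distinct_adj (map f w)"
    using w f by (simp add: DS_sequence_def distinct_adj_mapI)
next
  fix a b :: 'b assume ab: "a \<noteq> b"
  show "alt_len a b (map f w) \<le> s + 1"
  proof (cases "a \<in> f ` set w \<and> b \<in> f ` set w")
    case True
    then obtain c d where cd: "c \<in> set w" "d \<in> set w" "a = f c" "b = f d" by auto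
    hence "insert c (insert d (set w)) = set w" by auto
    hence "alt_len a b (map f w) = alt_len c d w"
      using f cd by (simp add: alt_len_map)
    moreover have "c \<noteq> d" using ab cd by auto
    ultimately show ?thesis using w by (simp add: DS_sequence_iff)
  next
    \<comment> \<open>Here \<open>a\<close> or \<open>b\<close> may lie outside the range where
      \<open>f\<close> is injective, but then one of them is absent from the word.\<close>
    case False
    hence "alt_len a b (map f w) \<le> 1"
      using alt_len_eq_0[of a "map f w" b] alt_len_le_1[of b "map f w" a] by auto
    thus ?thesis using s by simp
  qed
qed

section \<open>Crude length bound and existence of the maximum\<close>

fun adj_count :: "'a \<Rightarrow> 'a \<Rightarrow> 'a list \<Rightarrow> nat" where
  "adj_count a b (x # y # w) = of_bool (x = a \<and> y = b) + adj_count a b (y # w)"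
| "adj_count a b w = 0"

lemma adj_count_le_alt_len:
  assumes "a \<noteq> b"
  shows "adj_count a b w \<le> alt_len a b w"
proof -
  \<comment> \<open>The second conjunct strengthens the induction: once a leading \<open>a\<close>
    is consumed the scan awaits \<open>b\<close>, which costs at most one occurrence.\<close>
  have "adj_count a b w \<le> alt_len a b w \<and> adj_count a b w \<le> Suc (alt_len b a w)"
    using assms by (induction a b w rule: adj_count.induct) auto
  thus ?thesis by simp
qed

text \<open>Without immediate repetitions, each pair of neighbouring positions is counted for
  exactly one ordered pair of distinct symbols.\<close>

lemma length_eq_sum_adj_count:
  assumes "finite S" "set w \<subseteq> S" "distinct_adj w"
  shows "length w \<le> (\<Sum>p\<in>{p \<in> S \<times> S. fst p \<noteq> snd p}. adj_count (fst p) (snd p) w) + 1"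
  using assms(2,3)
proof (induction w rule: induct_list012)
  case (3 x y w)
  define P where "P = {p \<in> S \<times> S. fst p \<noteq> snd p}"
  have P: "finite P" "(x, y) \<in> P"
    using 3 assms(1) by (auto simp: P_def)
  have "(\<Sum>p\<in>P. adj_count (fst p) (snd p) (x # y # w)) =
    (\<Sum>p\<in>P. of_bool (p = (x, y))) + (\<Sum>p\<in>P. adj_count (fst p) (snd p) (y # w))"
    unfolding sum.distrib[symmetric] by (intro sum.cong) auto
  also have "(\<Sum>p\<in>P. of_bool (p = (x, y))) = (1::nat)"
    using P by (simp add: of_bool_def)
  finally show ?case using 3 by (simp add: P_def[symmetric])
qed auto

text \<open>Serves to make the set of lengths finite, so that \<open>Max\<close> in
  \<open>DS_max\<close> bounds every member.\<close>

lemma length_DS_sequence_le: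
  assumes "DS_sequence s w"
  shows "length w \<le> (s + 1) * (card (set w))\<^sup>2 + 1"
proof -
  define P where "P = {p \<in> set w \<times> set w. fst p \<noteq> snd p}"
  have "length w \<le> (\<Sum>p\<in>P. adj_count (fst p) (snd p) w) + 1"
    unfolding P_def using assms by (intro length_eq_sum_adj_count) (auto simp: DS_sequence_def)
  also have "(\<Sum>p\<in>P. adj_count (fst p) (snd p) w) \<le> (\<Sum>p\<in>P. s + 1)"
    using assms unfolding DS_sequence_iff P_def
    by (intro sum_mono order.trans[OF adj_count_le_alt_len]) auto
  also have "\<dots> \<le> (s + 1) * card (set w \<times> set w)"
    unfolding P_def sum_constant of_nat_id mult.commute[of _ "s + 1"]
    by (intro mult_left_mono card_mono) auto
  finally show ?thesis by (simp add: power2_eq_square card_cartesian_product)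
qed

lemma DS_max_ge:
  fixes w :: "nat list"
  assumes "DS_sequence s w" "card (set w) = n"
  shows "length w \<le> DS_max s n"
  unfolding DS_max_def
proof (rule Max_ge)
  have "length ` DS s n \<subseteq> {..(s + 1) * n\<^sup>2 + 1}"
    using length_DS_sequence_le by (auto simp: DS_def)
  thus "finite (length ` DS s n)" by (rule finite_subset) simp
  show "length w \<in> length ` DS s n"
    using assms by (intro imageI) (simp add: DS_def)
qed

section \<open>Lower bounds per symbol\<close>

text \<open>A certificate for \<open>R s n\<close> \<ge> \<open>c\<close>. It keeps a witness over a
  canonical alphabet, so that sequences can be renamed and glued together.\<close>

definition rate :: "nat \<Rightarrow> nat \<Rightarrow> real \<Rightarrow> bool" where
  "rate s n c \<longleftrightarrow>
     (\<exists>w :: nat list. DS_sequence s w \<and> set w = {..<n} \<and> c * real n \<le> real (length w))"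

lemma DS_max_ge_rate: "rate s n c \<Longrightarrow> c * real n \<le> real (DS_max s n)"
  unfolding rate_def using DS_max_ge by fastforce

lemma rate_mono: "rate s n c \<Longrightarrow> s \<le> t \<Longrightarrow> d \<le> c \<Longrightarrow> rate t n d"
  unfolding rate_def
  by (meson DS_sequence_mono mult_right_mono of_nat_0_le_iff order.trans)

text \<open>Renaming along a bijection lets witnesses be built over any type, such as pairs of field
  elements.\<close>

lemma rateI:
  assumes "DS_sequence s w" "finite A" "set w = A" "card A = n" "s \<ge> 1"
    "c * real n \<le> real (length w)"
  shows "rate s n c"
proof -
  obtain h where h: "bij_betw h A {0..<n}"
    using ex_bij_betw_finite_nat[OF assms(2)] assms(4) by auto
  have "DS_sequence s (map h w)"
    using assms h by (intro DS_sequence_map) (auto simp: bij_betw_def)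
  moreover have "set (map h w) = {..<n}"
    using h assms(3) by (auto simp: bij_betw_def atLeast0LessThan)
  ultimately show ?thesis
    unfolding rate_def using assms(6) by (intro exI[of _ "map h w"]) simp
qed

lemma rateE:
  assumes "rate s n c" "finite A" "card A = n" "s \<ge> 1"
  obtains w where "DS_sequence s w" "set w = A" "c * real n \<le> real (length w)"
proof -
  obtain v :: "nat list" where v: "DS_sequence s v" "set v = {..<n}" "c * real n \<le> real (length v)"
    using assms(1) by (auto simp: rate_def)
  obtain h where h: "bij_betw h {0..<n} A"
    using ex_bij_betw_nat_finite[OF assms(2)] assms(3) by auto
  show ?thesis
  proof (rule that[of "map h v"])
    show "DS_sequence s (map h v)"
      using assms h v by (intro DS_sequence_map) (auto simp: bij_betw_def atLeast0LessThan)
  qed (use v h in \<open>auto simp: bij_betw_def atLeast0LessThan\<close>)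
qed

lemma alt_len_distinct: "distinct w \<Longrightarrow> a \<noteq> b \<Longrightarrow> alt_len a b w \<le> 2"
  by (induction w arbitrary: a b) (auto simp: numeral_2_eq_2 intro!: alt_len_le_1[unfolded One_nat_def])

lemma DS_sequence_upt: "s \<ge> 1 \<Longrightarrow> DS_sequence s [0..<n]"
  unfolding DS_sequence_iff
  by (auto simp: distinct_adj_conv_nth intro!: order.trans[OF alt_len_distinct])

lemma rate_upt: "s \<ge> 1 \<Longrightarrow> rate s n 1"
  unfolding rate_def by (intro exI[of _ "[0..<n]"]) (auto simp: atLeast0LessThan DS_sequence_upt)

lemma alts_concat_replicate: "alts a b (concat (replicate k w)) \<le> k * alts a b w"
proof (induction k)
  case (Suc k)
  thus ?case using alts_append[of a b w "concat (replicate k w)"] by simp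
qed simp

text \<open>Each of the \<open>k\<close> copies of the increasing word adds at most 2 to an
  alternation, giving 2k in total, which order \<open>2 * k - 1\<close> allows.\<close>

lemma rate_repeat:
  assumes "n \<ge> 2" "k \<ge> 1"
  shows "rate (2 * k - 1) n (real k)"
proof -
  define w where "w = concat (replicate k [0..<n])"
  have "distinct_adj [0..<n]" by (simp add: distinct_adj_conv_nth)
  \<comment> \<open>The first symbol is tracked for the joints: a copy ends in \<open>n - 1\<close>,
    which differs from 0 as \<open>n\<close> \<ge> 2.\<close>
  have dist: "distinct_adj (concat (replicate k [0..<n]))
      \<and> (k > 0 \<longrightarrow> hd (concat (replicate k [0..<n])) = 0)" for k
    using \<open>distinct_adj [0..<n]\<close> assms(1)
    by (induction k) (auto simp: distinct_adj_append_iff hd_append)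
  have "alts a b [0..<n] \<le> 2" if "a \<noteq> b" for a b
    using that DS_sequence_alts[OF DS_sequence_upt[of 1 n]] by fastforce
  hence "alts a b w \<le> k * 2" if "a \<noteq> b" for a b
    unfolding w_def using that by (intro order.trans[OF alts_concat_replicate] mult_left_mono) auto
  hence "DS_sequence (2 * k - 1) w"
    unfolding DS_sequence_iff_alts using dist[of k] assms by (auto simp: w_def mult.commute)
  moreover have "length w = k * n"
    by (simp add: w_def length_concat sum_list_replicate)
  moreover have "set w = {..<n}"
    using assms by (auto simp: w_def)
  ultimately show ?thesis
    unfolding rate_def by (intro exI[of _ w]) simp
qed

lemma DS_sequence_append_disjoint:
  assumes "DS_sequence s u" "DS_sequence s v" "set u \<inter> set v = {}" "s \<ge> 1"
  shows "DS_sequence s (u @ v)"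
  unfolding DS_sequence_iff_alts
proof (intro conjI allI impI)
  have "last u \<noteq> hd v" if "u \<noteq> []" "v \<noteq> []"
    using assms(3) last_in_set[OF that(1)] hd_in_set[OF that(2)] by (metis disjoint_iff)
  thus "distinct_adj (u @ v)"
    using assms by (auto simp: DS_sequence_def distinct_adj_append_iff)
next
  fix a b :: 'a assume ab: "a \<noteq> b"
  have bounds: "alts a b u \<le> s + 1" "alts a b v \<le> s + 1"
    using DS_sequence_alts[OF assms(1) ab] DS_sequence_alts[OF assms(2) ab] by auto
  consider "a \<notin> set u" "b \<notin> set u" | "a \<notin> set v" "b \<notin> set v"
    | "a \<notin> set u \<or> b \<notin> set u" "a \<notin> set v \<or> b \<notin> set v"
    using assms(3) by blast
  thus "alts a b (u @ v) \<le> s + 1"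
  proof cases
    \<comment> \<open>Each part misses one of the two symbols and contributes at most 1; the total 2
      is within \<open>s + 1\<close>.\<close>
    case 3
    thus ?thesis
      using alts_append[of a b u v] alts_le_1[of a u b] alts_le_1[of a v b] assms(4) by linarith
  qed (use alts_append[of a b u v] bounds alts_eq_0[of a u b] alts_eq_0[of a v b] in linarith)+
qed

lemma rate_add:
  assumes "rate s n c" "rate s n' c'" "s \<ge> 1" "d * real (n + n') \<le> c * real n + c' * real n'"
  shows "rate s (n + n') d"
proof -
  obtain u where u: "DS_sequence s u" "set u = {..<n}" "c * real n \<le> real (length u)"
    using assms(1) by (auto simp: rate_def)
  obtain v where v: "DS_sequence s v" "set v = {n..<n+n'}" "c' * real n' \<le> real (length v)"
    using assms(2,3) by (auto elim: rateE[of s n' c' "{n..<n+n'}"])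
  have "DS_sequence s (u @ v)"
    using assms u v by (intro DS_sequence_append_disjoint) auto
  thus ?thesis
    unfolding rate_def using u v assms(4) by (intro exI[of _ "u @ v"]) auto
qed

lemma rate_mult:
  assumes "rate s n c" "s \<ge> 1"
  shows "rate s (d * n) c"
proof (induction d)
  case 0
  show ?case by (auto simp: rate_def DS_sequence_iff)
next
  case (Suc d)
  show ?case using rate_add[OF assms(1) Suc assms(2), of c] by (simp add: algebra_simps)
qed

text \<open>Disjoint copies on \<open>N div n * n\<close> symbols cover at least half of
  \<open>N\<close>, and an increasing word fills the remainder. Any alphabet size can thus be
  rounded down at the cost of a factor 2.\<close>

lemma rate_ge:
  assumes "rate s n c" "s \<ge> 1" "0 < n" "n \<le> N" "c \<ge> 0"
  shows "rate s N (c / 2)"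
proof -
  have N: "N div n * n + N mod n = N" by simp
  have "N mod n < n" using assms by simp
  also have "n \<le> N div n * n" using assms by (simp add: div_greater_zero_iff Suc_le_eq)
  finally have "N \<le> 2 * (N div n * n)" using N by linarith
  hence "real N \<le> 2 * real (N div n * n)"
    by (metis of_nat_le_iff of_nat_mult of_nat_numeral)
  hence "c * real N \<le> c * (2 * real (N div n * n))"
    using assms by (intro mult_left_mono) auto
  hence "rate s (N div n * n + N mod n) (c / 2)"
    by (intro rate_add[OF rate_mult[OF assms(1,2)] rate_upt[OF assms(2)]] assms(2)) (use N in simp)
  thus ?thesis by (simp only: N)
qed

section \<open>The squaring step\<close>


text \<open>The label \<open>g\<close> separates the blocks, so no symbol is repeated at a joint;
  the alternation bound is subadditivity of \<open>alts\<close>.\<close>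

lemma concat_blocks:
  assumes W: "\<And>y. y \<in> set ys \<Longrightarrow> distinct_adj (W y) \<and> (\<forall>a \<in> set (W y). g a = y) \<and> W y \<noteq> []"
    and "distinct ys"
  shows "distinct_adj (concat (map W ys)) \<and>
    alts a b (concat (map W ys)) \<le> (\<Sum>y\<in>set ys. alts a b (W y))"
  using assms
proof (induction ys)
  case (Cons y ys)
  let ?v = "concat (map W ys)"
  have IH: "distinct_adj ?v" "alts a b ?v \<le> (\<Sum>y\<in>set ys. alts a b (W y))"
    using Cons by auto
  have "last (W y) \<noteq> hd ?v" if "?v \<noteq> []"
  proof
    assume eq: "last (W y) = hd ?v"
    have "hd ?v \<in> set ?v" using that by (rule hd_in_set)
    then obtain y' where y': "y' \<in> set ys" "hd ?v \<in> set (W y')" by auto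
    hence "g (hd ?v) = y'" using Cons.prems(1)[of y'] by auto
    moreover have "g (last (W y)) = y" using Cons.prems(1)[of y] by auto
    ultimately show False using y' eq Cons.prems(2) by auto
  qed
  hence "distinct_adj (W y @ ?v)"
    using IH Cons.prems(1)[of y] by (auto simp: distinct_adj_append_iff)
  moreover have "alts a b (W y @ ?v) \<le> (\<Sum>y\<in>set (y # ys). alts a b (W y))"
    using alts_append[of a b "W y" ?v] IH(2) Cons.prems(2) by simp
  ultimately show ?case by simp
qed simp

text \<open>The freedom to choose \<open>z\<close> lets consecutive phases be joined without an immediate repetition.\<close>

lemma phase_exists:
  fixes g :: "'a \<Rightarrow> 'b"
  assumes rate: "rate s m c" and s: "s \<ge> 1" and m: "m \<ge> 1"
    and T: "finite T" "g ` T \<subseteq> Y"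
    and Y: "finite Y" "card Y \<ge> 2"
    and fibre: "\<And>y. y \<in> Y \<Longrightarrow> card {a \<in> T. g a = y} = m"
  obtains u where "set u = T" "distinct_adj u" "last u \<noteq> z"
    "real (card Y) * (c * real m) \<le> real (length u)"
    "\<forall>a\<in>T. \<forall>b\<in>T. a \<noteq> b \<longrightarrow> alts a b u \<le> (if g a = g b then s + 1 else 2)"
proof -
  have "\<exists>w. DS_sequence s w \<and> set w = {a \<in> T. g a = y} \<and> c * real m \<le> real (length w)" if "y \<in> Y" for y
  proof -
    have "finite {a \<in> T. g a = y}" using T by simp
    show ?thesis
      by (rule rateE[OF rate \<open>finite {a \<in> T. g a = y}\<close> fibre[OF that] s]) (intro exI conjI)
  qed
  hence "\<forall>y\<in>Y. \<exists>w. DS_sequence s w \<and> set w = {a \<in> T. g a = y} \<and> c * real m \<le> real (length w)"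
    by blast
  from bchoice[OF this] obtain W where W: "\<And>y. y \<in> Y \<Longrightarrow> DS_sequence s (W y)"
    "\<And>y. y \<in> Y \<Longrightarrow> set (W y) = {a \<in> T. g a = y}"
    "\<And>y. y \<in> Y \<Longrightarrow> c * real m \<le> real (length (W y))"
    by blast
  have W_ne: "W y \<noteq> []" if "y \<in> Y" for y
  proof
    assume "W y = []"
    hence "{a \<in> T. g a = y} = {}" using W(2)[OF that] by simp
    thus False using fibre[OF that] m by (simp only: card.empty)
  qed
  \<comment> \<open>The block of \<open>y0\<close> is placed last; its symbols have a label other
    than \<open>g z\<close>, so the phase cannot end in \<open>z\<close>.\<close>
  obtain y0 where y0: "y0 \<in> Y" "y0 \<noteq> g z"
  proof -
    have "\<not> Y \<subseteq> {g z}" using Y(2) card_mono[of "{g z}" Y] by auto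
    thus ?thesis using that by auto
  qed
  obtain zs where zs: "set zs = Y - {y0}" "distinct zs"
    using finite_distinct_list[of "Y - {y0}"] Y(1) by auto
  define ys where "ys = zs @ [y0]"
  have ys: "set ys = Y" "distinct ys" using zs y0 by (auto simp: ys_def)
  define u where "u = concat (map W ys)"
  have blocks: "distinct_adj u" "alts a b u \<le> (\<Sum>y\<in>Y. alts a b (W y))" for a b
  proof -
    have "distinct_adj (W y) \<and> (\<forall>a \<in> set (W y). g a = y) \<and> W y \<noteq> []" if "y \<in> set ys" for y
      using W(1,2)[of y] W_ne[of y] that ys(1) by (simp add: DS_sequence_def)
    from concat_blocks[OF this ys(2), of a b]
    show "distinct_adj u" "alts a b u \<le> (\<Sum>y\<in>Y. alts a b (W y))"
      unfolding u_def ys(1) by simp_all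
  qed
  show ?thesis
  proof (rule that)
    show "set u = T" using W(2) ys T(2) by (auto simp: u_def)
    show "distinct_adj u" by fact
    have "last u = last (W y0)" using W_ne y0 by (simp add: u_def ys_def)
    moreover have "last (W y0) \<in> set (W y0)" using W_ne y0 by (intro last_in_set) auto
    ultimately show "last u \<noteq> z" using W(2)[OF y0(1)] y0 by auto
    have "real (card Y) * (c * real m) = (\<Sum>y\<in>Y. c * real m)" by simp
    also have "\<dots> \<le> (\<Sum>y\<in>Y. real (length (W y)))" using W by (intro sum_mono) auto
    also have "\<dots> = real (length u)"
      unfolding u_def length_concat using ys by (simp add: o_def sum_list_distinct_conv_sum_set)
    finally show "real (card Y) * (c * real m) \<le> real (length u)" .
    show "\<forall>a\<in>T. \<forall>b\<in>T. a \<noteq> b \<longrightarrow> alts a b u \<le> (if g a = g b then s + 1 else 2)"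
    proof (intro ballI impI)
      fix a b assume ab: "a \<in> T" "b \<in> T" "a \<noteq> b"
      have gY: "g a \<in> Y" "g b \<in> Y" using T ab by auto
      have "alts a b u \<le> (\<Sum>y\<in>Y. alts a b (W y))" by (rule blocks)
      \<comment> \<open>All other blocks contain neither symbol. If the two labels agree, one block
        carries the whole alternation; otherwise two blocks carry at most 1 each.\<close>
      also have "\<dots> = (\<Sum>y\<in>{g a, g b}. alts a b (W y))"
        using gY Y(1) ab W(2) by (intro sum.mono_neutral_right ballI alts_eq_0) auto
      also have "\<dots> \<le> (if g a = g b then s + 1 else 2)"
      proof (cases "g a = g b")
        case True
        thus ?thesis using DS_sequence_alts[OF W(1)[OF gY(1)] ab(3)] by simp
      next
        case False
        have "alts a b (W (g a)) \<le> 1" "alts a b (W (g b)) \<le> 1"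
          using False W(2)[OF gY(1)] W(2)[OF gY(2)] by (intro alts_le_1; auto)+
        thus ?thesis using False by simp
      qed
      finally show "alts a b u \<le> (if g a = g b then s + 1 else 2)" .
    qed
  qed
qed

text \<open>One phase per element of \<open>xs\<close>, each prepended to what is already built.
  Lengths add up, and so do the alternation bounds of each pair of symbols.\<close>

lemma phases_exist:
  fixes f :: "'c \<Rightarrow> 'a \<Rightarrow> 'b"
  assumes rate: "rate s m c" and s: "s \<ge> 1" and m: "m \<ge> 1"
    and T: "finite T" "\<And>x. x \<in> set xs \<Longrightarrow> f x ` T \<subseteq> Y"
    and Y: "finite Y" "card Y \<ge> 2"
    and fibre: "\<And>x y. x \<in> set xs \<Longrightarrow> y \<in> Y \<Longrightarrow> card {a \<in> T. f x a = y} = m"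
  shows "\<exists>u. set u = (if xs = [] then {} else T) \<and> distinct_adj u \<and>
    real (length xs) * (real (card Y) * (c * real m)) \<le> real (length u) \<and>
    (\<forall>a\<in>T. \<forall>b\<in>T. a \<noteq> b \<longrightarrow> alts a b u \<le> (\<Sum>x\<leftarrow>xs. if f x a = f x b then s + 1 else 2))"
  using T(2) fibre
proof (induction xs)
  case (Cons x xs)
  have prems: "f x ` T \<subseteq> Y" "\<And>y. y \<in> Y \<Longrightarrow> card {a \<in> T. f x a = y} = m"
    using Cons.prems by (meson list.set_intros(1))+
  have "\<exists>u. set u = (if xs = [] then {} else T) \<and> distinct_adj u \<and>
    real (length xs) * (real (card Y) * (c * real m)) \<le> real (length u) \<and>
    (\<forall>a\<in>T. \<forall>b\<in>T. a \<noteq> b \<longrightarrow> alts a b u \<le> (\<Sum>x\<leftarrow>xs. if f x a = f x b then s + 1 else 2))"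
    by (rule Cons.IH) (rule Cons.prems; simp)+
  then obtain u where u: "set u = (if xs = [] then {} else T)" "distinct_adj u"
    "real (length xs) * (real (card Y) * (c * real m)) \<le> real (length u)"
    "\<forall>a\<in>T. \<forall>b\<in>T. a \<noteq> b \<longrightarrow> alts a b u \<le> (\<Sum>x\<leftarrow>xs. if f x a = f x b then s + 1 else 2)"
    by (elim exE conjE)
  \<comment> \<open>For empty \<open>xs\<close>, \<open>hd u\<close> is an arbitrary value, and
    avoiding it does no harm.\<close>
  obtain v where v: "set v = T" "distinct_adj v" "last v \<noteq> hd u"
    "real (card Y) * (c * real m) \<le> real (length v)"
    "\<forall>a\<in>T. \<forall>b\<in>T. a \<noteq> b \<longrightarrow> alts a b v \<le> (if f x a = f x b then s + 1 else 2)"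
    by (rule phase_exists[OF rate s m T(1) prems(1) Y prems(2), where z = "hd u"])
  show ?case
  proof (intro exI[of _ "v @ u"] conjI ballI impI)
    fix a b assume "a \<in> T" "b \<in> T" "a \<noteq> b"
    hence "alts a b u \<le> (\<Sum>x\<leftarrow>xs. if f x a = f x b then s + 1 else 2)"
      "alts a b v \<le> (if f x a = f x b then s + 1 else 2)"
      using u(4) v(5) by blast+
    thus "alts a b (v @ u) \<le> (\<Sum>x\<leftarrow>x # xs. if f x a = f x b then s + 1 else 2)"
      using alts_append[of a b v u] by (simp del: One_nat_def)
  next
    show "set (v @ u) = (if x # xs = [] then {} else T)" using u(1) v(1) by simp
    show "distinct_adj (v @ u)" using u(2) v(2,3) by (simp add: distinct_adj_append_iff)
    show "real (length (x # xs)) * (real (card Y) * (c * real m)) \<le> real (length (v @ u))"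
      using u(3) v(4) by (simp add: distrib_right)
  qed
qed auto

text \<open>With q = \<open>2 ^ j\<close>, each of the \<open>k\<close> phases consists of q blocks
  of length at least c q. Two distinct lines pay 2 in every phase except possibly one, where they
  pay \<open>s + 1\<close>; the sum is at most \<open>s + 2 * (k - 1) + 1\<close>.\<close>

lemma rate_square:
  assumes rate: "rate s (2 ^ j) c" and s: "s \<ge> 1" and j: "j \<ge> 1" and k: "1 \<le> k" "k \<le> 2 ^ j"
  shows "rate (s + 2 * (k - 1)) (2 ^ j * 2 ^ j) (real k * c)"
proof -
  obtain F :: "bit alg_closure set" where F: "finite F" "card F = 2 ^ j"
    and closed: "\<And>x y. x \<in> F \<Longrightarrow> y \<in> F \<Longrightarrow> x - y \<in> F"
    "\<And>x y. x \<in> F \<Longrightarrow> y \<in> F \<Longrightarrow> x + y \<in> F" "\<And>x y. x \<in> F \<Longrightarrow> y \<in> F \<Longrightarrow> x * y \<in> F"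
    using finite_subfield_char_two[of j] j by auto
  have F2: "card F \<ge> 2" using j F(2) power_increasing[of 1 j "2::nat"] by simp
  obtain D where D: "D \<subseteq> F" "card D = k" "finite D"
    using k F by (metis obtain_subset_with_card_n)
  then obtain xs where xs: "set xs = D" "distinct xs" using finite_distinct_list by auto
  have len: "length xs = k" using xs D by (metis distinct_card)
  define T where "T = F \<times> F"
  define f where "f x p = fst p * x + snd p" for x :: "bit alg_closure" and p
  have fS: "f x ` T \<subseteq> F" if "x \<in> set xs" for x
    using that D(1) closed by (auto simp: f_def T_def xs(1))
  have fibre: "card {p \<in> T. f x p = y} = 2 ^ j" if "x \<in> set xs" "y \<in> F" for x y
  proof -
    \<comment> \<open>The slope is free and the intercept is then determined by the point
      (\<open>x\<close>, \<open>y\<close>).\<close>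
    have "{p \<in> T. f x p = y} = (\<lambda>a. (a, y - a * x)) ` F"
      using that D(1) closed by (auto simp: T_def f_def xs(1) image_iff)
    moreover have "inj_on (\<lambda>a. (a, y - a * x)) F" by (auto simp: inj_on_def)
    ultimately show ?thesis using F by (simp add: card_image)
  qed
  have "finite T" using F by (simp add: T_def)
  have "\<exists>u. set u = (if xs = [] then {} else T) \<and> distinct_adj u \<and>
    real (length xs) * (real (card F) * (c * real (2 ^ j))) \<le> real (length u) \<and>
    (\<forall>p\<in>T. \<forall>p'\<in>T. p \<noteq> p' \<longrightarrow>
       alts p p' u \<le> (\<Sum>x\<leftarrow>xs. if f x p = f x p' then s + 1 else 2))"
    by (rule phases_exist[OF rate s _ \<open>finite T\<close> fS F(1) F2 fibre]) simp_all
  moreover have "xs \<noteq> []" using k len by auto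
  ultimately obtain u where u: "set u = T" "distinct_adj u"
    "real k * (real (card F) * (c * real (2 ^ j))) \<le> real (length u)"
    "\<forall>p\<in>T. \<forall>p'\<in>T. p \<noteq> p' \<longrightarrow>
       alts p p' u \<le> (\<Sum>x\<leftarrow>xs. if f x p = f x p' then s + 1 else 2)"
    unfolding len by (simp only: if_False) (elim exE conjE)
  have "DS_sequence (s + 2 * (k - 1)) u"
    unfolding DS_sequence_iff_alts
  proof (intro conjI allI impI)
    fix p p' :: "bit alg_closure \<times> bit alg_closure" assume ne: "p \<noteq> p'"
    show "alts p p' u \<le> s + 2 * (k - 1) + 1"
    proof (cases "p \<in> T \<and> p' \<in> T")
      case True
      define G where "G = {x \<in> D. f x p = f x p'}"
      have "x = x'" if "x \<in> G" "x' \<in> G" for x x'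
      proof (rule ccontr)
        assume x: "x \<noteq> x'"
        \<comment> \<open>Lines agreeing at two abscissae have equal slopes, hence equal
          intercepts.\<close>
        have "(fst p - fst p') * (x - x') = (f x p - f x p') - (f x' p - f x' p')"
          by (simp add: f_def algebra_simps)
        also have "\<dots> = 0" using that by (simp add: G_def)
        finally have "(fst p - fst p') * (x - x') = 0" .
        hence "fst p = fst p'" using x by simp
        moreover from this have "snd p = snd p'" using that by (simp add: G_def f_def)
        ultimately show False using ne by (simp add: prod_eq_iff)
      qed
      hence G: "card G \<le> 1" "finite G" "G \<subseteq> D"
        using D(3) by (auto simp: G_def card_le_Suc0_iff_eq)
      have "alts p p' u \<le> (\<Sum>x\<in>D. if f x p = f x p' then s + 1 else 2)"
        using u(4) True ne xs by (simp add: sum_list_distinct_conv_sum_set)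
      also have "\<dots> = (\<Sum>x\<in>D. 2 + (if x \<in> G then s - 1 else 0))"
        using s by (intro sum.cong) (auto simp: G_def)
      also have "\<dots> = k * 2 + card G * (s - 1)"
        unfolding sum.distrib using D G by (simp add: sum.If_cases Int_absorb1)
      also have "\<dots> \<le> k * 2 + 1 * (s - 1)"
        using G by (intro add_left_mono mult_right_mono) auto
      finally show ?thesis using s k by simp
    next
      case False
      thus ?thesis using alts_le_1[of p u p'] u(1) by auto
    qed
  qed (rule u)
  moreover have "card T = 2 ^ j * 2 ^ j" using F by (simp add: T_def card_cartesian_product)
  moreover have "real k * c * real (2 ^ j * 2 ^ j) \<le> real (length u)"
    using u(3) unfolding F(2) of_nat_mult by (simp only: mult_ac)
  ultimately show ?thesis
    using u(1) s \<open>finite T\<close> by (intro rateI[of _ u T]) simp_all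
qed

section \<open>Iterating the squaring step\<close>

text \<open>Each squaring doubles the exponent of the alphabet size, costs
  \<open>2 * (k - 1)\<close> of the order and gains a factor \<open>k\<close>. The bound on
  \<open>k\<close> persists as the alphabet grows.\<close>

lemma rate_tower:
  assumes "rate s (2 ^ r) c" "s \<ge> 1" "r \<ge> 1" "1 \<le> k" "k \<le> 2 ^ r"
  shows "rate (s + 2 * l * (k - 1)) (2 ^ (r * 2 ^ l)) (real k ^ l * c)"
proof (induction l)
  case 0
  show ?case using assms(1) by simp
next
  case (Suc l)
  have "r \<le> r * 2 ^ l" by simp
  hence "k \<le> 2 ^ (r * 2 ^ l)"
    using assms(5) by (meson le_trans one_le_numeral power_increasing)
  from rate_square[OF Suc _ _ assms(4) this] assms(2,3)
  have "rate (s + 2 * l * (k - 1) + 2 * (k - 1)) (2 ^ (r * 2 ^ l) * 2 ^ (r * 2 ^ l))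
      (real k * (real k ^ l * c))"
    by simp
  moreover have "s + 2 * l * m + 2 * m = s + 2 * Suc l * m" for m
    by (simp add: algebra_simps)
  moreover have "(2::nat) ^ (r * 2 ^ l) * 2 ^ (r * 2 ^ l) = 2 ^ (r * 2 ^ Suc l)"
    by (simp flip: power_add)
  ultimately show ?case by (simp only: power_Suc mult.assoc)
qed

lemma rate_half: "s \<ge> 1 \<Longrightarrow> n \<ge> 2 \<Longrightarrow> rate s n (real s / 2)"
  by (rule rate_mono[OF rate_repeat[of n "(s + 1) div 2"]]) (linarith | simp)+

text \<open>Both sides agree at \<open>f = 1\<close>; below that, the tangent of the exponential has
  slope \<open>ln 2\<close> < 1 after halving, so it stays above \<open>f\<close>.\<close>

lemma two_powr_ge:
  assumes "f \<le> (1::real)"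
  shows "2 * f \<le> 2 powr f"
proof -
  have "f \<le> 1 + (f - 1) * ln 2"
    using mult_right_mono_neg[of "ln 2" 1 "f - 1"] assms ln_2_less_1 by (simp add: mult.commute)
  also have "\<dots> \<le> exp ((f - 1) * ln 2)" by (rule exp_ge_add_one_self)
  also have "\<dots> = 2 powr f / 2" by (simp add: powr_def exp_diff left_diff_distrib)
  finally show ?thesis by simp
qed

text \<open>One squaring step over the trivial bound: about half of \<open>x\<close> pays for
  \<open>k\<close> phases, and order at least \<open>x / 2\<close> remains for rate
  \<open>x / 4\<close>. The constant 32 collects 4 from this rate, 4 from \<open>k\<close> against
  \<open>x powr f\<close>, and 2 from rounding \<open>2 ^ r\<close> down to
  \<open>q * q\<close>.\<close>

lemma rate_bottom:
  assumes x: "x \<ge> 1" "x \<le> real s" and f: "0 \<le> f" "f \<le> 1" and r: "r \<ge> 2"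
    and large: "x powr (2 * f) / 2 \<le> 2 ^ r"
  shows "rate s (2 ^ r) (x powr (1 + f) / 32)"
proof -
  define j where "j = r div 2"
  define q :: nat where "q = 2 ^ j"
  \<comment> \<open>Capped by \<open>q\<close>, the number of available abscissae, and by
    \<open>\<lceil>x / 4\<rceil>\<close>, so that \<open>2 * (k - 1)\<close> \<le>
    \<open>x / 2\<close>.\<close>
  define k where "k = min q (nat \<lceil>x / 4\<rceil>)"
  have j: "j \<ge> 1" using r by (simp add: j_def)
  have q2: "q \<ge> 2" using j power_increasing[of 1 j "2::nat"] by (simp add: q_def)
  have "r = j + j \<or> r = Suc (j + j)" unfolding j_def by linarith
  hence qr: "q * q \<le> 2 ^ r" "(2::nat) ^ r \<le> 2 * (q * q)"
    by (auto simp: q_def power_add)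
  have k1: "1 \<le> k" using q2 x by (simp add: k_def) linarith
  have k_less: "real k - 1 \<le> x / 4" using x by (simp add: k_def) linarith
  define t where "t = s - 2 * (k - 1)"
  have "2 * (k - 1) \<le> s" using k_less k1 x by linarith
  hence s_eq: "s = t + 2 * (k - 1)" by (simp add: t_def)
  hence "real s = real t + 2 * (real k - 1)" using k1 by (simp add: of_nat_diff)
  moreover have "2 * (real k - 1) \<le> x / 2" using k_less by simp
  ultimately have t: "x / 2 \<le> real t" using x(2) by linarith
  hence t1: "t \<ge> 1" using x by linarith
  have "rate t q (x / 4)"
    by (rule rate_mono[OF rate_half[OF t1 q2]]) (use t in auto)
  hence "rate t (2 ^ j) (x / 4)" by (simp only: q_def)
  from rate_square[OF this t1 j k1] have "rate s (q * q) (real k * (x / 4))"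
    using s_eq by (simp add: k_def q_def)
  from rate_ge[OF this _ _ qr(1)] have "rate s (2 ^ r) (real k * (x / 4) / 2)"
    using x q2 k1 by (simp add: s_eq t1)
  moreover have "x powr f / 4 \<le> real k"
  proof -
    have "(x powr f) ^ 2 = x powr (2 * f)" using x by (simp add: powr_power mult.commute)
    also have "\<dots> \<le> 2 * real (2 ^ r)" using large by simp
    also have "\<dots> \<le> 2 * real (2 * (q * q))" by (intro mult_left_mono of_nat_mono qr(2)) simp
    also have "\<dots> = (2 * real q) ^ 2" by (simp add: power2_eq_square)
    finally have "x powr f \<le> 2 * real q" by (rule power2_le_imp_le) simp
    moreover have "x powr f \<le> x powr 1" using x f by (intro powr_mono) auto
    hence "x powr f / 4 \<le> real (nat \<lceil>x / 4\<rceil>)" using x by simp linarith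
    ultimately show ?thesis by (simp add: k_def)
  qed
  hence "x powr f / 4 * x / 8 \<le> real k * x / 8" using x by (intro divide_right_mono mult_right_mono) auto
  hence "x powr (1 + f) / 32 \<le> real k * (x / 4) / 2" using x by (simp add: powr_add mult.commute)
  ultimately show ?thesis by (rule rate_mono[OF _ order_refl])
qed

lemma rate_loglog:
  fixes s n :: nat
  defines "L \<equiv> loglog_base s n"
  assumes s: "s \<ge> 4" and n: "n \<ge> 2" and L: "L \<ge> 0"
  shows "rate s n ((real s / (2 * L + 1)) powr (L + 1) / 64)"
proof -
  define x where "x = real s / (2 * L + 1)"
  show ?thesis
  proof (cases "x \<le> 1")
    \<comment> \<open>The claimed rate is below 1, which an increasing word attains.\<close>
    case True
    have "x powr (L + 1) \<le> 1 powr (L + 1)"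
      using True L by (intro powr_mono2) (auto simp: x_def)
    thus ?thesis
      using s unfolding x_def by (intro rate_mono[OF rate_upt[of s]]) auto
  next
    case False
    hence x: "x \<ge> 1" by simp
    define l where "l = nat \<lfloor>L\<rfloor>"
    define f where "f = L - real l"
    have f: "0 \<le> f" "f \<le> 1" "L = real l + f" using L by (auto simp: f_def l_def) linarith+
    have xs: "x \<le> real s" using L s by (simp add: x_def field_simps)
    \<comment> \<open>This is the \<open>2 ^ l\<close>-th root of \<open>n\<close>, since log_s n =
      \<open>2 powr L\<close> = \<open>2 ^ l * 2 powr f\<close>.\<close>
    define t where "t = real s powr (2 powr f)"
    have "real s powr (log (real s) (real n)) = real n" using s n by simp
    moreover have "log (real s) (real n) = 2 powr L"
      using s n by (simp add: L_def loglog_base_def)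
    ultimately have n_eq: "real n = t ^ (2 ^ l)"
      using s f(3) by (simp add: t_def powr_power powr_add powr_realpow mult.commute)
    have t_s: "real s \<le> t"
      using s f powr_mono[of 1 "2 powr f" "real s"] ge_one_powr_ge_zero[of 2 f] by (simp add: t_def)
    define r where "r = nat \<lfloor>log 2 t\<rfloor>"
    have "log 2 4 \<le> log 2 t" using t_s s by (subst log_le_cancel_iff) auto
    moreover have "log 2 4 = (2::real)" using log_pow_cancel[of "2::real" 2] by simp
    ultimately have r2: "r \<ge> 2" by (simp add: r_def le_nat_iff le_floor_iff)
    have r_log: "real r \<le> log 2 t" "log 2 t \<le> real r + 1"
      using r2 by (simp_all add: r_def)  linarith+
    have "2 powr real r \<le> t" "t \<le> 2 powr (real r + 1)"
      using r_log t_s s by (simp_all add: le_log_iff log_le_iff)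
    hence r: "2 ^ r \<le> t" "t \<le> 2 * 2 ^ r" by (simp_all add: powr_realpow powr_add)
    \<comment> \<open>For \<open>l = 0\<close> no squaring takes place, and
      \<open>\<lceil>x\<rceil>\<close> might exceed \<open>2 ^ r\<close>, so 1 is taken instead. For
      \<open>l\<close> \<ge> 1, \<open>x\<close> \<le> \<open>s / 2\<close> \<le>
      \<open>t / 2\<close> \<le> \<open>2 ^ r\<close>.\<close>
    define k where "k = (if l = 0 then 1 else nat \<lceil>x\<rceil>)"
    have k: "1 \<le> k" "k \<le> 2 ^ r"
    proof -
      show "1 \<le> k" using x by (simp add: k_def) linarith
      show "k \<le> 2 ^ r"
      proof (cases "l = 0")
        case False
        hence "2 * L + 1 \<ge> 2" using f by simp
        hence "x \<le> real s / 2" unfolding x_def by (intro divide_left_mono) auto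
        hence "x \<le> real (2 ^ r)" using t_s r by simp
        thus ?thesis using False by (simp add: k_def ceiling_le_iff nat_le_iff)
      qed (simp add: k_def)
    qed
    have kx: "real l * (real k - 1) \<le> real l * x" "x ^ l \<le> real k ^ l"
    proof -
      have "l \<noteq> 0 \<Longrightarrow> real k - 1 \<le> x \<and> x \<le> real k" using x by (simp add: k_def)
      thus "real l * (real k - 1) \<le> real l * x" "x ^ l \<le> real k ^ l"
        using x by (cases "l = 0"; auto intro!: mult_left_mono power_mono)+
    qed
    \<comment> \<open>The order left after \<open>l\<close> squarings. Since
      \<open>s = x * (2 * l + 2 * f + 1)\<close> and \<open>k - 1\<close> \<le> \<open>x\<close>
      whenever \<open>l\<close> \<ge> 1, at least \<open>x\<close> remains for the bottom
      level.\<close>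
    define s' where "s' = s - 2 * l * (k - 1)"
    have budget: "real s = x * (2 * L + 1)" using L by (simp add: x_def)
    have "x * 1 \<le> x * (2 * f + 1)" using x f by (intro mult_left_mono) auto
    hence "2 * (real l * (real k - 1)) + x \<le> real s"
      using kx(1) unfolding budget f(3) by (simp add: algebra_simps)
    moreover have "real (2 * l * (k - 1)) = 2 * (real l * (real k - 1))"
      using k by (simp add: of_nat_diff)
    ultimately have le: "real (2 * l * (k - 1)) + x \<le> real s" by (simp only:)
    hence "2 * l * (k - 1) \<le> s" using x by linarith
    hence s_eq: "s = s' + 2 * l * (k - 1)" by (simp add: s'_def)
    hence s': "x \<le> real s'" using le by linarith
    \<comment> \<open>Here \<open>2 * f\<close> \<le> \<open>2 powr f\<close> shows that the bottom
      alphabet, of size at least \<open>t / 2\<close>, is large enough for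
      \<open>rate_bottom\<close>.\<close>
    have "x powr (2 * f) \<le> x powr (2 powr f)"
      using x f two_powr_ge by (intro powr_mono) auto
    also have "\<dots> \<le> t" unfolding t_def using x xs by (intro powr_mono2) auto
    finally have "rate s' (2 ^ r) (x powr (1 + f) / 32)"
      using x s' f r2 r by (intro rate_bottom) auto
    from rate_tower[OF this _ _ k, of l]
    have "rate s (2 ^ (r * 2 ^ l)) (real k ^ l * (x powr (1 + f) / 32))"
      using r2 s' x unfolding s_eq[symmetric] by simp
    moreover have "2 ^ (r * 2 ^ l) \<le> n"
    proof -
      have "(2 ^ r) ^ (2 ^ l) \<le> t ^ (2 ^ l)" using r by (intro power_mono) auto
      hence "real (2 ^ (r * 2 ^ l)) \<le> real n" by (simp add: n_eq power_mult)
      thus ?thesis by (simp only: of_nat_le_iff)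
    qed
    ultimately have "rate s n (real k ^ l * (x powr (1 + f) / 32) / 2)"
      using s by (intro rate_ge) auto
    moreover have "x powr (L + 1) / 64 \<le> real k ^ l * (x powr (1 + f) / 32) / 2"
    proof -
      have "x powr (L + 1) = x ^ l * x powr (1 + f)"
        using x by (simp add: f(3) powr_realpow flip: powr_add) (simp add: add_ac powr_add powr_realpow)
      also have "\<dots> \<le> real k ^ l * x powr (1 + f)"
        using kx by (intro mult_right_mono) auto
      finally show ?thesis by simp
    qed
    ultimately show ?thesis unfolding x_def by (rule rate_mono[OF _ order_refl])
  qed
qed

text \<open>Covers orders exceeding \<open>n\<close>. The base is at least 1 and the exponent below
  1, so the target power is at most \<open>s / d\<close>, and the trivial rate \<open>s / 2\<close>
  suffices.\<close>

lemma rate_loglog_neg: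
  assumes s: "s \<ge> 1" and n: "n \<ge> 2" and d: "0 < d" "d \<le> 2 * L + 1" and L: "L < 0"
  shows "rate s n (d / 2 * (real s / (2 * L + 1)) powr (L + 1))"
proof (rule rate_mono[OF rate_half[OF s n] order_refl])
  have "real s / (2 * L + 1) \<ge> 1" using s d L by (simp add: field_simps)
  hence "(real s / (2 * L + 1)) powr (L + 1) \<le> (real s / (2 * L + 1)) powr 1"
    using L by (intro powr_mono) auto
  also have "\<dots> \<le> real s / d" using d s by (simp add: frac_le)
  finally have "(real s / (2 * L + 1)) powr (L + 1) \<le> real s / d" .
  hence "d / 2 * (real s / (2 * L + 1)) powr (L + 1) \<le> d / 2 * (real s / d)"
    using d by (intro mult_left_mono) auto
  thus "d / 2 * (real s / (2 * L + 1)) powr (L + 1) \<le> real s / 2" using d by simp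
qed

section \<open>Asymptotic statements\<close>

text \<open>As log log n tends to infinity, so does \<open>s\<close>; this provides the bound
  \<open>s\<close> \<ge> 4 for \<open>rate_loglog\<close>.\<close>

lemma eventually_large_of_Omega_loglog:
  fixes s :: "nat \<Rightarrow> nat"
  assumes "(\<lambda>n. real (s n)) \<in> \<Omega>(\<lambda>n. log 2 (log 2 (real n)))"
  shows "\<forall>\<^sub>F n in sequentially. m \<le> s n"
proof -
  obtain c where c: "c > 0"
    "\<forall>\<^sub>F n in sequentially. norm (real (s n)) \<ge> c * norm (log 2 (log 2 (real n)))"
    using assms by (elim landau_omega.bigE)
  have "filterlim (\<lambda>n::nat. c * log 2 (log 2 (real n))) at_top sequentially"
    using c(1) by real_asymp
  hence "\<forall>\<^sub>F n::nat in sequentially. c * log 2 (log 2 (real n)) \<ge> real m"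
    by (simp add: filterlim_at_top)
  with c(2) show ?thesis
  proof eventually_elim
    case (elim n)
    have "c * log 2 (log 2 (real n)) \<le> c * \<bar>log 2 (log 2 (real n))\<bar>"
      using c(1) by (intro mult_left_mono) auto
    thus ?case using elim by simp
  qed
qed

lemma DS_max_Omega:
  fixes s :: "nat \<Rightarrow> nat"
  assumes "(\<lambda>n. real (s n)) \<in> \<Omega>(\<lambda>n. log 2 (log 2 (real n)))"
    and d: "d > 0" "\<forall>\<^sub>F n in sequentially. d \<le> 2 * loglog_base (s n) n + 1"
  shows "(\<lambda>n. real (DS_max (s n) n)) \<in>
        \<Omega>(\<lambda>n. real n * (real (s n) / (2 * loglog_base (s n) n + 1))
                        powr (loglog_base (s n) n + 1))"
proof (rule landau_omega.bigI)
  \<comment> \<open>The two constants belong to the cases of nonnegative and negative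
    \<open>loglog_base\<close>.\<close>
  show "min (1 / 64) (d / 2) > 0" using d by simp
  show "\<forall>\<^sub>F n in sequentially. norm (real (DS_max (s n) n)) \<ge> min (1 / 64) (d / 2) *
      norm (real n * (real (s n) / (2 * loglog_base (s n) n + 1)) powr (loglog_base (s n) n + 1))"
    using d(2) eventually_large_of_Omega_loglog[OF assms(1), of 4] eventually_ge_at_top[of 2]
  proof eventually_elim
    case (elim n)
    let ?L = "loglog_base (s n) n"
    let ?p = "(real (s n) / (2 * ?L + 1)) powr (?L + 1)"
    have "rate (s n) n (min (1 / 64) (d / 2) * ?p)"
    proof (cases "?L \<ge> 0")
      case True
      have "min (1 / 64) (d / 2) * ?p \<le> 1 / 64 * ?p" by (intro mult_right_mono) auto
      thus ?thesis
        using elim True by (intro rate_mono[OF rate_loglog[of "s n" n] order_refl]) auto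
    next
      case False
      have "min (1 / 64) (d / 2) * ?p \<le> d / 2 * ?p" by (intro mult_right_mono) auto
      thus ?thesis
        using False elim d(1)
        by (intro rate_mono[OF rate_loglog_neg[of "s n" n d ?L] order_refl]) auto
    qed
    from DS_max_ge_rate[OF this] show ?case by (simp add: abs_mult mult_ac)
  qed
qed

text \<open>With v = log log n and s = \<lfloor>log n\<rfloor>, L = v - log log s lies between v/2
  and v, and the base is at least 2^(v/2). The rate is therefore at least 2^(v^2/4) / 64.\<close>

lemma DS_max_log_ge:
  "\<forall>\<^sub>F n in sequentially. 2 powr (1 / 8 * (log 2 (log 2 (real n)))\<^sup>2)
          \<le> real (DS_max (nat \<lfloor>log 2 (real n)\<rfloor>) n) / real n"
proof -
  have "\<forall>\<^sub>F v::real in at_top. v - log 2 v \<ge> v / 2 \<and> (2 powr v - 1) / (2 * v + 1) \<ge> 2 powr (v / 2)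
      \<and> v \<ge> 7"
    by (intro eventually_conj; real_asymp)
  moreover have "filterlim (\<lambda>n::nat. log 2 (log 2 (real n))) at_top sequentially"
    by real_asymp
  ultimately have "\<forall>\<^sub>F n::nat in sequentially. (let v = log 2 (log 2 (real n)) in
      v - log 2 v \<ge> v / 2 \<and> (2 powr v - 1) / (2 * v + 1) \<ge> 2 powr (v / 2) \<and> v \<ge> 7)"
    unfolding Let_def by (rule eventually_compose_filterlim)
  moreover have "\<forall>\<^sub>F n::nat in sequentially. log 2 (real n) \<ge> 5" by real_asymp
  ultimately show ?thesis
    using eventually_ge_at_top[of 2]
  proof eventually_elim
    case (elim n)
    define u where "u = log 2 (real n)"
    define v where "v = log 2 u"
    define s where "s = nat \<lfloor>u\<rfloor>"
    define L where "L = loglog_base s n"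
    have v: "v - log 2 v \<ge> v / 2" "(2 powr v - 1) / (2 * v + 1) \<ge> 2 powr (v / 2)" "v \<ge> 7"
      using elim by (simp_all add: u_def v_def Let_def)
    have u: "u \<ge> 5" "2 powr v = u" using elim by (simp_all add: u_def v_def)
    have s: "s \<ge> 4" "real s \<le> u" "u - 1 \<le> real s" using u by (simp_all add: s_def) linarith+
    have log_s: "2 \<le> log 2 (real s)" "log 2 (real s) \<le> v"
      using s u by (simp_all add: v_def le_log_iff)
    have "log (real s) (real n) = u / log 2 (real s)"
      using s elim by (subst log_base_change[of 2]) (auto simp: u_def)
    hence L_eq: "L = v - log 2 (log 2 (real s))"
      using u log_s by (simp add: L_def loglog_base_def v_def log_divide)
    have "log 2 (log 2 (real s)) \<le> log 2 v" using log_s v by simp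
    hence L1: "L \<ge> v / 2" using L_eq v by linarith
    have "0 \<le> log 2 (log 2 (real s))" using log_s by simp
    hence L2: "L \<le> v" using L_eq by linarith
    have "2 powr (v / 2) \<le> (2 powr v - 1) / (2 * v + 1)" by (rule v)
    also have "\<dots> \<le> real s / (2 * L + 1)"
      using s u v L1 L2 by (intro frac_le) auto
    finally have base: "2 powr (v / 2) \<le> real s / (2 * L + 1)" .
    \<comment> \<open>Half of the exponent is given up to absorb the factor 64 = 2^6, which
      \<open>v\<close> \<ge> 7 permits because 49/8 > 6.\<close>
    have "2 powr (v\<^sup>2 / 8) = 2 powr (v\<^sup>2 / 4) / 2 powr (v\<^sup>2 / 8)"
      by (simp flip: powr_diff)
    also have "\<dots> \<le> 2 powr (v\<^sup>2 / 4) / 2 powr 6"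
    proof -
      have "7 ^ 2 \<le> v ^ 2" using v by (intro power_mono) auto
      thus ?thesis by (intro divide_left_mono powr_mono) auto
    qed
    also have "2 powr (v\<^sup>2 / 4) = (2 powr (v / 2)) powr (v / 2)"
      by (simp add: powr_powr power2_eq_square)
    also have "\<dots> \<le> (2 powr (v / 2)) powr (L + 1)"
      using L1 v by (intro powr_mono) (auto intro: ge_one_powr_ge_zero)
    also have "\<dots> \<le> (real s / (2 * L + 1)) powr (L + 1)"
      using base L1 v by (intro powr_mono2) auto
    finally have le: "2 powr (v\<^sup>2 / 8) \<le> (real s / (2 * L + 1)) powr (L + 1) / 64"
      by (simp add: divide_right_mono)
    have "rate s n ((real s / (2 * L + 1)) powr (L + 1) / 64)"
      unfolding L_def using s elim L1 v by (intro rate_loglog) (auto simp: L_def)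
    hence "rate s n (2 powr (v\<^sup>2 / 8))" by (rule rate_mono[OF _ order_refl le])
    from DS_max_ge_rate[OF this] have "2 powr (v\<^sup>2 / 8) \<le> real (DS_max s n) / real n"
      using elim by (simp add: pos_le_divide_eq)
    thus ?case unfolding s_def v_def u_def by simp
  qed
qed

text \<open>The condition on \<open>d\<close> keeps the denominator positive and away from 0: it
  vanishes when s = n^(sqrt 2) and is negative for larger s.\<close>

theorem theorem5:
  "(\<forall>s :: nat \<Rightarrow> nat.
      (\<lambda>n. real (s n)) \<in> \<Omega>(\<lambda>n. log 2 (log 2 (real n))) \<longrightarrow>
      (\<exists>d > 0. \<forall>\<^sub>F n in sequentially. d \<le> 2 * loglog_base (s n) n + 1) \<longrightarrow>
      (\<lambda>n. real (DS_max (s n) n)) \<in>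
        \<Omega>(\<lambda>n. real n * (real (s n) / (2 * loglog_base (s n) n + 1))
                        powr (loglog_base (s n) n + 1)))
   \<and> (\<exists>c > 0. \<forall>\<^sub>F n in sequentially.
        2 powr (c * (log 2 (log 2 (real n)))\<^sup>2)
          \<le> real (DS_max (nat \<lfloor>log 2 (real n)\<rfloor>) n) / real n)"
proof (intro conjI allI impI)
  show "\<exists>c > 0. \<forall>\<^sub>F n in sequentially. 2 powr (c * (log 2 (log 2 (real n)))\<^sup>2)
          \<le> real (DS_max (nat \<lfloor>log 2 (real n)\<rfloor>) n) / real n"
    using DS_max_log_ge by (intro exI[of _ "1 / 8"]) simp
qed (use DS_max_Omega in blast)

end
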